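(* Let $X$ be a real Banach space with a normalized Schauder basis $(e_n)_{n\in\mathbb N}$ and let $w=(w_n)$ be a weight sequence. (a) If $(e_n)$ is $C_p$-$w$-partially greedy, then $(e_n)$ is $(C_p+1)$-quasi-greedy and has $C_p$-$w$-left Property $(A)$. (b) If $(e_n)$ has $C_{la}$-$w$-left Property $(A)$ and is $C_q$-quasi-greedy, then $(e_n)$ is $(C_q+1)C_{la}$-$w$-partially greedy.
   Context: Let $(e_n^* )$ be the biorthogonal functionals of $(e_n)$, and $\mathrm{supp}(x)=\{n: e_n^*(x)\ne0\}$. A weight sequence $w=(w_n)_{n\in\mathbb N}$ is a sequence of positive real numbers; $w(A)=\sum_{i\in A}w_i$ for $A\subset\mathbb N$. $\mathbb N^{<\infty}$ is the set of all finite subsets of $\mathbb N$ (including $\emptyset$). $\mathcal A$ is the set of all sequences $\varepsilon=(\varepsilon_i)_{i\in\mathbb N}$ with $\varepsilon_i\in\{1,-1\}$. For $A\in\mathbb N^{<\infty}$ and $\varepsilon\in\mathcal A$: $1_{\varepsilon A}=\sum_{i\in A}\varepsilon_ie_i$ and $P_A(x)=\sum_{i\in A}e_i^*(x)e_i$. $A<B$ means that every element of $A$ is smaller than every element of $B$ (so it holds if $A$ or $B$ is empty); for $n\in\mathbb N$, $A<n$ means $A<\{n\}$. For $x\in X$ and $m\in\mathbb N$, $\Lambda_m(x)$ denotes any set of $m$ indices with $\min_{n\in\Lambda_m(x)}|e_n^*(x)|\ge\max_{n\notin\Lambda_m(x)}|e_n^*(x)|$; the corresponding $m$-th greedy approximant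 is $G_m(x)=\sum_{n\in\Lambda_m(x)}e_n^*(x)e_n$, and $\alpha_m(x)=\min\Lambda_m(x)$. Conditions involving $G_m(x)$ are required for every admissible choice of $\Lambda_m(x)$. $(e_n)$ is $C$-quasi-greedy if $\|G_m(x)\|\le C\|x\|$ for all $x\in X$, $m\in\mathbb N$. $(e_n)$ is $C$-$w$-partially greedy if for all $x\in X$, $m\in\mathbb N$, $$\|x-G_m(x)\|\le C\inf\{\|x-P_A(x)\|: A\in\mathbb N^{<\infty},\ w(A)\le w(\Lambda_m(x)),\ A<\alpha_m(x)\}.$$ $(e_n)$ has $C$-$w$-left Property $(A)$ ($C\ge1$) if $\|x+t1_{\varepsilon A}\|\le C\|x+t1_{\eta B}\|$ for all $x\in X$, $t\ge\sup_j|e_j^*(x)|$, $A,B\in\mathbb N^{<\infty}$ with $A<B$, $w(A)\le w(B)$, $\mathrm{supp}(x)\cap(A\cup B)=\emptyset$, and $\varepsilon,\eta\in\mathcal A$. *)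

theory Defs
  imports "HOL-Analysis.Analysis"
begin

text \<open>
  Bases are indexed by \<^typ>\<open>nat\<close>, so the first index is 0. Only the order of the indices matters.
\<close>

definition schauder_basis :: "(nat \<Rightarrow> 'a::real_normed_vector) \<Rightarrow> bool" where
  "schauder_basis e \<longleftrightarrow> (\<forall>x. \<exists>!a :: nat \<Rightarrow> real. (\<lambda>n. a n *\<^sub>R e n) sums x)"

definition normalized :: "(nat \<Rightarrow> 'a::real_normed_vector) \<Rightarrow> bool" where
  "normalized e \<longleftrightarrow> (\<forall>n. norm (e n) = 1)"

text \<open>
  The biorthogonal functionals: \<open>coef e n x\<close> is the value at \<open>x\<close> of the \<open>n\<close>-th one, that is, the
  \<open>n\<close>-th coefficient in the expansion of \<open>x\<close>. Meaningful only if \<open>e\<close> is a Schauder basis.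
\<close>

definition coef :: "(nat \<Rightarrow> 'a::real_normed_vector) \<Rightarrow> nat \<Rightarrow> 'a \<Rightarrow> real" where
  "coef e n x = (THE a. (\<lambda>k. a k *\<^sub>R e k) sums x) n"

definition supp :: "(nat \<Rightarrow> 'a::real_normed_vector) \<Rightarrow> 'a \<Rightarrow> nat set" where
  "supp e x = {n. coef e n x \<noteq> 0}"

definition weight :: "(nat \<Rightarrow> real) \<Rightarrow> bool" where
  "weight w \<longleftrightarrow> (\<forall>n. w n > 0)"

definition signs :: "(nat \<Rightarrow> real) set" where
  "signs = {\<epsilon>. \<forall>i. \<epsilon> i \<in> {1, -1}}"

definition ind :: "(nat \<Rightarrow> 'a::real_normed_vector) \<Rightarrow> (nat \<Rightarrow> real) \<Rightarrow> nat set \<Rightarrow> 'a" where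
  "ind e \<epsilon> A = (\<Sum>i\<in>A. \<epsilon> i *\<^sub>R e i)"

definition proj :: "(nat \<Rightarrow> 'a::real_normed_vector) \<Rightarrow> nat set \<Rightarrow> 'a \<Rightarrow> 'a" where
  "proj e A x = (\<Sum>i\<in>A. coef e i x *\<^sub>R e i)"

definition set_before :: "nat set \<Rightarrow> nat set \<Rightarrow> bool" where
  "set_before A B \<longleftrightarrow> (\<forall>a\<in>A. \<forall>b\<in>B. a < b)"

text \<open>
  \<open>greedy_set e m x L\<close>: the set \<open>L\<close> is an admissible choice of \<open>\<Lambda>\<^sub>m(x)\<close>. The corresponding greedy
  approximant \<open>G\<^sub>m(x)\<close> is \<open>proj e L x\<close>, and \<open>\<alpha>\<^sub>m(x)\<close> is \<open>Min L\<close>.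
\<close>

definition greedy_set :: "(nat \<Rightarrow> 'a::real_normed_vector) \<Rightarrow> nat \<Rightarrow> 'a \<Rightarrow> nat set \<Rightarrow> bool" where
  "greedy_set e m x L \<longleftrightarrow> finite L \<and> card L = m \<and>
     (\<forall>n\<in>L. \<forall>k. k \<notin> L \<longrightarrow> \<bar>coef e n x\<bar> \<ge> \<bar>coef e k x\<bar>)"

definition quasi_greedy :: "(nat \<Rightarrow> 'a::real_normed_vector) \<Rightarrow> real \<Rightarrow> bool" where
  "quasi_greedy e C \<longleftrightarrow>
     (\<forall>x m L. m \<ge> 1 \<and> greedy_set e m x L \<longrightarrow> norm (proj e L x) \<le> C * norm x)"

definition partially_greedy ::
  "(nat \<Rightarrow> 'a::real_normed_vector) \<Rightarrow> (nat \<Rightarrow> real) \<Rightarrow> real \<Rightarrow> bool" where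
  "partially_greedy e w C \<longleftrightarrow>
     (\<forall>x m L. m \<ge> 1 \<and> greedy_set e m x L \<longrightarrow>
        norm (x - proj e L x) \<le>
          C * (INF A\<in>{A. finite A \<and> sum w A \<le> sum w L \<and> set_before A {Min L}}.
                 norm (x - proj e A x)))"

text \<open>
  The real supremum below is genuine when \<open>e\<close> is a normalized Schauder basis: the coefficients of
  every vector then tend to 0, hence are bounded.
\<close>

definition left_property_A ::
  "(nat \<Rightarrow> 'a::real_normed_vector) \<Rightarrow> (nat \<Rightarrow> real) \<Rightarrow> real \<Rightarrow> bool" where
  "left_property_A e w C \<longleftrightarrow> C \<ge> 1 \<and>
     (\<forall>x t A B \<epsilon> \<eta>. t \<ge> (SUP j. \<bar>coef e j x\<bar>) \<and> finite A \<and> finite B \<and> set_before A B \<and>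
        sum w A \<le> sum w B \<and> supp e x \<inter> (A \<union> B) = {} \<and> \<epsilon> \<in> signs \<and> \<eta> \<in> signs \<longrightarrow>
        norm (x + t *\<^sub>R ind e \<epsilon> A) \<le> C * norm (x + t *\<^sub>R ind e \<eta> B))"

end

theory Submission
  imports Defs
begin

text \<open>
  For the left Property (A), apply the partially greedy inequality to
  \<open>x + t 1\<^sub>\<epsilon>\<^sub>A + t 1\<^sub>\<eta>\<^sub>B\<close>, for which \<open>B\<close> is a greedy set. The bound \<open>C\<^sub>p \<ge> 1\<close> holds because
  \<open>C\<^sub>p < 1\<close> would make the norms of \<open>e\<^sub>0 + \<dots> + e\<^sub>n\<close> grow geometrically. Conversely, let \<open>L\<close> be
  a greedy set of \<open>x\<close>, \<open>t\<close> the least modulus of a coefficient on \<open>L\<close>, and \<open>A\<close> a competitor. By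
  convexity, the coefficients of \<open>x - P\<^sub>L x\<close> on \<open>A\<close> may be replaced by \<open>\<plusminus>t\<close>, and the left
  Property (A) moves them to \<open>L\<close>. The result is the truncation of \<open>u = x - P\<^sub>A x\<close> at height \<open>t\<close>,
  a convex combination of greedy remainders of \<open>u\<close>.
\<close>

subsection \<open>Coefficients\<close>

lemma coef_sums:
  assumes "schauder_basis e"
  shows "(\<lambda>k. coef e k x *\<^sub>R e k) sums x"
proof -
  have "\<exists>!a. (\<lambda>k. a k *\<^sub>R e k) sums x"
    using assms unfolding schauder_basis_def by blast
  from theI'[OF this] show ?thesis
    unfolding coef_def .
qed

lemma coef_eqI:
  assumes "schauder_basis e" and "(\<lambda>k. a k *\<^sub>R e k) sums x"
  shows "coef e n x = a n"
proof -
  have "\<exists>!a. (\<lambda>k. a k *\<^sub>R e k) sums x"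
    using assms(1) unfolding schauder_basis_def by blast
  then have "(\<lambda>k. coef e k x) = a"
    using coef_sums[OF assms(1), of x] assms(2) by auto
  then show ?thesis
    by meson
qed

lemma coef_add:
  assumes "schauder_basis e"
  shows "coef e n (x + y) = coef e n x + coef e n y"
proof (rule coef_eqI[OF assms])
  show "(\<lambda>k. (coef e k x + coef e k y) *\<^sub>R e k) sums (x + y)"
    using sums_add[OF coef_sums[OF assms] coef_sums[OF assms]]
    by (simp add: scaleR_add_left)
qed

lemma coef_diff:
  assumes "schauder_basis e"
  shows "coef e n (x - y) = coef e n x - coef e n y"
proof (rule coef_eqI[OF assms])
  show "(\<lambda>k. (coef e k x - coef e k y) *\<^sub>R e k) sums (x - y)"
    using sums_diff[OF coef_sums[OF assms] coef_sums[OF assms]]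
    by (simp add: scaleR_diff_left)
qed

lemma coef_scaleR:
  assumes "schauder_basis e"
  shows "coef e n (c *\<^sub>R x) = c * coef e n x"
proof (rule coef_eqI[OF assms])
  show "(\<lambda>k. (c * coef e k x) *\<^sub>R e k) sums (c *\<^sub>R x)"
    using sums_scaleR_right[OF coef_sums[OF assms]] by simp
qed

lemma coef_sum_basis:
  assumes "schauder_basis e" and "finite A"
  shows "coef e n (\<Sum>i\<in>A. c i *\<^sub>R e i) = (if n \<in> A then c n else 0)"
proof (rule coef_eqI[OF assms(1)])
  have "(\<lambda>k. if k \<in> A then c k *\<^sub>R e k else 0) sums (\<Sum>i\<in>A. c i *\<^sub>R e i)"
    by (rule sums_If_finite_set[OF assms(2)])
  then show "(\<lambda>k. (if k \<in> A then c k else 0) *\<^sub>R e k) sums (\<Sum>i\<in>A. c i *\<^sub>R e i)"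
    by (rule back_subst[where P = "\<lambda>f. f sums _"]) auto
qed

lemma coef_ind:
  assumes "schauder_basis e" and "finite A"
  shows "coef e n (ind e \<epsilon> A) = (if n \<in> A then \<epsilon> n else 0)"
  unfolding ind_def by (rule coef_sum_basis[OF assms])

lemma coef_proj:
  assumes "schauder_basis e" and "finite A"
  shows "coef e n (proj e A x) = (if n \<in> A then coef e n x else 0)"
  unfolding proj_def by (rule coef_sum_basis[OF assms])

lemmas coef_simps = coef_add coef_diff coef_scaleR coef_ind coef_proj

text \<open>The terms of a convergent series tend to 0, and \<open>norm (e k) = 1\<close> passes
  this on to the coefficients. It makes the supremum in \<open>left_property_A\<close> a bound for
  every coefficient.\<close>

lemma coef_bdd_above:
  assumes "schauder_basis e" and "normalized e"
  shows "bdd_above (range (\<lambda>j. \<bar>coef e j x\<bar>))"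
proof -
  have "(\<lambda>k. coef e k x *\<^sub>R e k) \<longlonglongrightarrow> 0"
    using coef_sums[OF assms(1)] sums_summable summable_LIMSEQ_zero by blast
  then have "(\<lambda>k. \<bar>coef e k x\<bar>) \<longlonglongrightarrow> 0"
    using assms(2) tendsto_norm_zero_iff[of "\<lambda>k. coef e k x *\<^sub>R e k"]
    by (simp add: normalized_def)
  then show ?thesis
    by (rule Bseq_bdd_above[OF convergent_imp_Bseq[OF convergentI]])
qed

lemma proj_ind_scaled:
  assumes "\<And>i. i \<in> A \<Longrightarrow> coef e i x = t * \<epsilon> i"
  shows "proj e A x = t *\<^sub>R ind e \<epsilon> A"
  using assms by (simp add: proj_def ind_def scaleR_sum_right)

lemma signs_abs: "\<epsilon> \<in> signs \<Longrightarrow> \<bar>\<epsilon> i\<bar> = 1"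
  by (auto simp: signs_def dest!: spec[of _ i])

lemma abs_coef_le:
  assumes "schauder_basis e" and "normalized e" and "(SUP j. \<bar>coef e j x\<bar>) \<le> t"
  shows "\<bar>coef e j x\<bar> \<le> t"
  using cSUP_upper[OF UNIV_I coef_bdd_above[OF assms(1,2)], of j x] assms(3) by linarith

subsection \<open>Convexity\<close>

text \<open>The vector lies on the segment from \<open>v\<close> to
  \<open>v + p *\<^sub>R u\<close>, where a convex function is at most its larger endpoint
  value.\<close>

lemma norm_add_scaleR_mult_le_max:
  fixes v u :: "'a::real_normed_vector"
  assumes "0 \<le> r" and "r \<le> 1"
  shows "norm (v + (r * p) *\<^sub>R u) \<le> max (norm v) (norm (v + p *\<^sub>R u))"
proof -
  have eq: "v + (r * p) *\<^sub>R u = (1 - r) *\<^sub>R v + r *\<^sub>R (v + p *\<^sub>R u)"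
    by (simp add: algebra_simps)
  have "norm (v + (r * p) *\<^sub>R u) \<le> (1 - r) * norm v + r * norm (v + p *\<^sub>R u)"
    unfolding eq by (rule norm_triangle_le) (use assms in simp)
  also have "\<dots> \<le> max (norm v) (norm (v + p *\<^sub>R u))"
    by (rule convex_bound_le) (use assms in auto)
  finally show ?thesis .
qed

lemma norm_add_scaleR_le_max:
  fixes v u :: "'a::real_normed_vector"
  assumes "\<bar>c\<bar> \<le> t"
  shows "norm (v + c *\<^sub>R u) \<le> max (norm (v + t *\<^sub>R u)) (norm (v - t *\<^sub>R u))"
proof (cases "t = 0")
  case True
  with assms show ?thesis by simp
next
  case False
  with assms have t: "t > 0" by linarith
  \<comment> \<open>Relative position of \<open>c\<close> in the interval from \<open>-t\<close> to
    \<open>t\<close>, measured from the left end.\<close>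
  define r where "r = (c + t) / (2 * t)"
  have r: "0 \<le> r" "r \<le> 1" "r * (2 * t) = c + t"
    using assms t by (auto simp: r_def field_simps)
  have "norm (v - t *\<^sub>R u + (r * (2 * t)) *\<^sub>R u)
    \<le> max (norm (v - t *\<^sub>R u)) (norm (v - t *\<^sub>R u + (2 * t) *\<^sub>R u))"
    using r(1,2) by (rule norm_add_scaleR_mult_le_max)
  moreover have "v - t *\<^sub>R u + (r * (2 * t)) *\<^sub>R u = v + c *\<^sub>R u"
    unfolding r(3) by (simp add: algebra_simps)
  moreover have "v - t *\<^sub>R u + (2 * t) *\<^sub>R u = v + t *\<^sub>R u"
    by (simp add: algebra_simps flip: scaleR_2)
  ultimately show ?thesis by (simp add: max.commute)
qed

text \<open>The norm is convex in each coefficient separately, so the coefficients can be pushed to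
  \<open>t\<close> or \<open>-t\<close> one at a time. An arbitrary \<open>v\<close> absorbs the
  coefficient that is still to be pushed.\<close>

lemma ex_signs_norm_le:
  assumes "finite A" and "\<And>i. i \<in> A \<Longrightarrow> \<bar>c i\<bar> \<le> t"
  shows "\<exists>\<epsilon>\<in>signs. norm (v + (\<Sum>i\<in>A. c i *\<^sub>R e i)) \<le> norm (v + t *\<^sub>R ind e \<epsilon> A)"
  using assms
proof (induction A arbitrary: v rule: finite_induct)
  case empty
  have "(\<lambda>_. 1) \<in> signs" by (simp add: signs_def)
  then show ?case by (auto simp: ind_def)
next
  case (insert a A)
  obtain \<epsilon> where \<epsilon>: "\<epsilon> \<in> signs"
    and le: "norm ((v + c a *\<^sub>R e a) + (\<Sum>i\<in>A. c i *\<^sub>R e i)) \<le> norm ((v + c a *\<^sub>R e a) + t *\<^sub>R ind e \<epsilon> A)"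
    using insert.IH[of "v + c a *\<^sub>R e a"] insert.prems by auto
  have upd: "ind e (\<epsilon>(a := s)) (insert a A) = s *\<^sub>R e a + ind e \<epsilon> A" for s
  proof -
    have "(\<Sum>i\<in>A. (\<epsilon>(a := s)) i *\<^sub>R e i) = (\<Sum>i\<in>A. \<epsilon> i *\<^sub>R e i)"
      using insert.hyps by (intro sum.cong) auto
    then show ?thesis using insert.hyps by (simp add: ind_def)
  qed
  have "norm ((v + t *\<^sub>R ind e \<epsilon> A) + c a *\<^sub>R e a)
    \<le> max (norm ((v + t *\<^sub>R ind e \<epsilon> A) + t *\<^sub>R e a)) (norm ((v + t *\<^sub>R ind e \<epsilon> A) - t *\<^sub>R e a))"
    by (rule norm_add_scaleR_le_max) (use insert.prems in auto)
  then have "\<exists>s\<in>{1, -1}. norm ((v + t *\<^sub>R ind e \<epsilon> A) + c a *\<^sub>R e a)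
      \<le> norm (v + t *\<^sub>R ind e (\<epsilon>(a := s)) (insert a A))"
    by (simp add: upd le_max_iff_disj algebra_simps)
  then obtain s where s: "s \<in> {1, -1}"
    and le': "norm ((v + t *\<^sub>R ind e \<epsilon> A) + c a *\<^sub>R e a)
      \<le> norm (v + t *\<^sub>R ind e (\<epsilon>(a := s)) (insert a A))"
    by blast
  have "\<epsilon>(a := s) \<in> signs" using \<epsilon> s by (auto simp: signs_def)
  moreover have "norm (v + (\<Sum>i\<in>insert a A. c i *\<^sub>R e i))
      \<le> norm (v + t *\<^sub>R ind e (\<epsilon>(a := s)) (insert a A))"
    using le le' insert.hyps by (simp add: add_ac)
  ultimately show ?case by blast
qed

text \<open>
  Adding the index of smallest modulus \<open>\<bar>c l\<bar>\<close> last: truncation at height \<open>\<bar>c l\<bar>\<close> fixes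
  that coefficient, so the induction hypothesis applies with \<open>c l *\<^sub>R e l\<close> absorbed into \<open>v\<close>;
  lower heights interpolate between this case and \<open>v\<close>.
\<close>

lemma norm_truncation_le:
  fixes v :: "'a::real_normed_vector"
  assumes "finite L" and "0 \<le> t" and "\<And>i. i \<in> L \<Longrightarrow> t \<le> \<bar>c i\<bar>"
    and "\<And>i. i \<in> L \<Longrightarrow> c i = \<bar>c i\<bar> * \<eta> i"
    and "\<And>S. S \<subseteq> L \<Longrightarrow> (\<And>n k. n \<in> S \<Longrightarrow> k \<in> L - S \<Longrightarrow> \<bar>c k\<bar> \<le> \<bar>c n\<bar>) \<Longrightarrow>
      norm (v + (\<Sum>i\<in>L - S. c i *\<^sub>R e i)) \<le> K"
  shows "norm (v + t *\<^sub>R ind e \<eta> L) \<le> K"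
  using assms
proof (induction L arbitrary: v t rule: finite_ranking_induct[where f = "\<lambda>i. - \<bar>c i\<bar>"])
  case empty
  then show ?case using empty(4)[of "{}"] by (simp add: ind_def)
next
  case (insert l L)
  show ?case
  proof (cases "l \<in> L")
    case True
    then show ?thesis using insert by (simp add: insert_absorb)
  next
    case False
    have min: "\<bar>c l\<bar> \<le> \<bar>c i\<bar>" if "i \<in> L" for i
      using insert.hyps(2)[OF that] by simp
    have "norm ((v + c l *\<^sub>R e l) + \<bar>c l\<bar> *\<^sub>R ind e \<eta> L) \<le> K"
    proof (rule insert.IH)
      fix S assume S: "S \<subseteq> L" and up: "\<And>n k. n \<in> S \<Longrightarrow> k \<in> L - S \<Longrightarrow> \<bar>c k\<bar> \<le> \<bar>c n\<bar>"
      \<comment> \<open>\<open>S\<close> also dominates the new index, because \<open>l\<close> has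
        the smallest modulus.\<close>
      have "norm (v + (\<Sum>i\<in>insert l L - S. c i *\<^sub>R e i)) \<le> K"
        by (rule insert.prems(4)) (use S up min in auto)
      moreover have "insert l L - S = insert l (L - S)"
        using S False by auto
      ultimately show "norm ((v + c l *\<^sub>R e l) + (\<Sum>i\<in>L - S. c i *\<^sub>R e i)) \<le> K"
        using insert.hyps False by (simp add: add_ac)
    qed (use insert.prems min in auto)
    moreover have "c l *\<^sub>R e l = \<bar>c l\<bar> *\<^sub>R (\<eta> l *\<^sub>R e l)"
      using insert.prems(3)[of l] by simp
    ultimately have top: "norm (v + \<bar>c l\<bar> *\<^sub>R ind e \<eta> (insert l L)) \<le> K"
      using insert.hyps False by (simp add: ind_def scaleR_add_right add_ac)
    \<comment> \<open>The endpoint at height 0: taking the whole of \<open>insert l L\<close> as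
      \<open>S\<close> leaves an empty sum.\<close>
    have bot: "norm v \<le> K"
      using insert.prems(4)[of "insert l L"] by simp
    have tl: "t \<le> \<bar>c l\<bar>" using insert.prems(2) by simp
    obtain r where r: "0 \<le> r" "r \<le> 1" "t = r * \<bar>c l\<bar>"
    proof (cases "c l = 0")
      case True
      then show ?thesis using that[of 0] tl insert.prems(1) by simp
    next
      case False
      then show ?thesis using that[of "t / \<bar>c l\<bar>"] tl insert.prems(1) by simp
    qed
    show ?thesis
      using norm_add_scaleR_mult_le_max[OF r(1,2), of v "\<bar>c l\<bar>" "ind e \<eta> (insert l L)"] top bot r(3)
      by simp
  qed
qed

subsection \<open>Consequences of partial greediness\<close>

lemma partially_greedyD:
  assumes "partially_greedy e w C" and "0 \<le> C" and "greedy_set e m x L" and "m \<ge> 1"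
    and "finite A" and "sum w A \<le> sum w L" and "set_before A {Min L}"
  shows "norm (x - proj e L x) \<le> C * norm (x - proj e A x)"
proof -
  let ?F = "{A. finite A \<and> sum w A \<le> sum w L \<and> set_before A {Min L}}"
  have "norm (x - proj e L x) \<le> C * (INF A\<in>?F. norm (x - proj e A x))"
    using assms(1,3,4) unfolding partially_greedy_def by blast
  also have "\<dots> \<le> C * norm (x - proj e A x)"
  proof (rule mult_left_mono[OF _ assms(2)])
    have "bdd_below ((\<lambda>A. norm (x - proj e A x)) ` ?F)"
      by (rule bdd_belowI2[where m = 0]) simp
    then show "(INF A\<in>?F. norm (x - proj e A x)) \<le> norm (x - proj e A x)"
      by (rule cINF_lower) (use assms(5-7) in auto)
  qed
  finally show ?thesis .
qed

lemma sum_weight_nonneg: "weight w \<Longrightarrow> 0 \<le> sum w A"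
  by (simp add: weight_def less_imp_le sum_nonneg)

text \<open>For \<open>e 0 + e 1\<close> and the greedy set \<open>{0}\<close>, the remainder
  \<open>e 1\<close> has norm 1 while the infimum is nonnegative, which excludes
  \<open>C \<le> 0\<close>. The sign of \<open>C\<close> must be known before the infimum is
  replaced by a single competitor.\<close>

lemma partially_greedy_pos:
  assumes "schauder_basis e" and "normalized e" and "weight w" and "partially_greedy e w C"
  shows "0 < C"
proof (rule ccontr)
  assume "\<not> 0 < C"
  define x where "x = ind e (\<lambda>_. 1) {0, 1}"
  have "greedy_set e 1 x {0}"
    by (simp add: greedy_set_def x_def coef_ind[OF assms(1)])
  then have "norm (x - proj e {0} x) \<le>
      C * (INF A\<in>{A. finite A \<and> sum w A \<le> sum w {0} \<and> set_before A {Min {0}}}.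
        norm (x - proj e A x))" (is "_ \<le> C * ?I")
    using assms(4) unfolding partially_greedy_def by blast
  moreover have "x - proj e {0} x = e 1"
    by (simp add: x_def proj_def coef_ind[OF assms(1)]) (simp add: ind_def)
  moreover have "0 \<le> ?I"
  proof (rule cINF_greatest)
    have "{} \<in> {A. finite A \<and> sum w A \<le> sum w {0} \<and> set_before A {Min {0}}}"
      using sum_weight_nonneg[OF assms(3), of "{0}"] by (simp add: set_before_def)
    then show "{A. finite A \<and> sum w A \<le> sum w {0} \<and> set_before A {Min {0}}} \<noteq> {}"
      by blast
  qed simp
  then have "C * ?I \<le> 0"
    using \<open>\<not> 0 < C\<close> by (simp add: mult_nonpos_nonneg)
  ultimately show False
    using assms(2) by (simp add: normalized_def)
qed

lemma partially_greedy_norm_le: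
  assumes "schauder_basis e" and "normalized e" and "weight w" and "partially_greedy e w C"
    and "greedy_set e m x L" and "m \<ge> 1"
  shows "norm (x - proj e L x) \<le> C * norm x"
  using partially_greedyD[OF assms(4) less_imp_le[OF partially_greedy_pos[OF assms(1-4)]]
      assms(5,6), of "{}"] sum_weight_nonneg[OF assms(3)]
  by (simp add: set_before_def proj_def)

lemma partially_greedy_ge_1:
  assumes "schauder_basis e" and "normalized e" and "weight w" and "partially_greedy e w C"
  shows "1 \<le> C"
proof (rule ccontr)
  assume "\<not> 1 \<le> C"
  then have C: "0 < C" "C < 1" using partially_greedy_pos[OF assms] by auto
  have step: "norm (sum e {..n}) \<le> C * norm (sum e {..Suc n})" for n
  proof -
    define x where "x = ind e (\<lambda>_. 1) {..Suc n}"
    \<comment> \<open>All nonzero coefficients are tied at 1, so the last index alone is an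
      admissible choice.\<close>
    have "greedy_set e 1 x {Suc n}"
      by (simp add: greedy_set_def x_def coef_ind[OF assms(1)])
    from partially_greedy_norm_le[OF assms this]
    have "norm (x - proj e {Suc n} x) \<le> C * norm x" by simp
    moreover have "proj e {Suc n} x = e (Suc n)"
      by (simp add: x_def proj_def coef_ind[OF assms(1)])
    ultimately show ?thesis by (simp add: x_def ind_def)
  qed
  have growth: "1 \<le> C ^ n * norm (sum e {..n})" for n
  proof (induction n)
    case 0
    then show ?case using assms(2) by (simp add: normalized_def)
  next
    case (Suc n)
    have "C ^ n * norm (sum e {..n}) \<le> C ^ n * (C * norm (sum e {..Suc n}))"
      using step C by (intro mult_left_mono) auto
    with Suc show ?case by (simp add: mult_ac)
  qed
  \<comment> \<open>The triangle inequality allows only linear growth, which geometric decay of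
    \<open>C ^ n\<close> defeats.\<close>
  have "1 \<le> real (Suc n) * C ^ n" for n
  proof -
    have "norm (sum e {..n}) \<le> (\<Sum>i\<le>n. 1)"
      by (rule sum_norm_le) (use assms(2) in \<open>simp add: normalized_def\<close>)
    then have "C ^ n * norm (sum e {..n}) \<le> C ^ n * real (Suc n)"
      using C by (intro mult_left_mono) auto
    with growth[of n] show ?thesis by (simp add: mult.commute)
  qed
  moreover have "(\<lambda>n. real (Suc n) * C ^ n) \<longlonglongrightarrow> 0"
  proof -
    have "(\<lambda>n. real n * C ^ n + C ^ n) \<longlonglongrightarrow> 0 + 0"
      using C by (intro tendsto_add powser_times_n_limit_0 LIMSEQ_power_zero) auto
    then show ?thesis by (simp add: algebra_simps)
  qed
  ultimately have "(1::real) \<le> 0"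
    by (intro LIMSEQ_le_const) auto
  then show False by simp
qed

lemma partially_greedy_imp_quasi_greedy:
  assumes "schauder_basis e" and "normalized e" and "weight w" and "partially_greedy e w C"
  shows "quasi_greedy e (C + 1)"
  unfolding quasi_greedy_def
proof (intro allI impI, elim conjE)
  fix x m L assume "m \<ge> (1::nat)" "greedy_set e m x L"
  then have "norm (x - proj e L x) \<le> C * norm x"
    using partially_greedy_norm_le[OF assms] by blast
  then show "norm (proj e L x) \<le> (C + 1) * norm x"
    using norm_triangle_sub[of "proj e L x" x]
    by (simp add: algebra_simps norm_minus_commute)
qed

lemma partially_greedy_imp_left_property_A:
  assumes "schauder_basis e" and "normalized e" and "weight w" and "partially_greedy e w C"
  shows "left_property_A e w C"
  unfolding left_property_A_def
proof (intro conjI allI impI, goal_cases)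
  case 1
  show ?case by (rule partially_greedy_ge_1[OF assms])
next
  case (2 x t A B \<epsilon> \<eta>)
  then have t: "(SUP j. \<bar>coef e j x\<bar>) \<le> t" and fin: "finite A" "finite B"
    and AB: "set_before A B" and w: "sum w A \<le> sum w B"
    and supp: "supp e x \<inter> (A \<union> B) = {}" and \<epsilon>: "\<epsilon> \<in> signs" and \<eta>: "\<eta> \<in> signs"
    by auto
  have C: "1 \<le> C" by (rule partially_greedy_ge_1[OF assms])
  have le: "\<bar>coef e j x\<bar> \<le> t" for j by (rule abs_coef_le[OF assms(1,2) t])
  have t0: "0 \<le> t" using le[of 0] by linarith
  show ?case
  \<comment> \<open>A greedy step needs a nonempty \<open>B\<close>. If \<open>B\<close> is empty,
    positivity of the weights forces \<open>A\<close> to be empty as well.\<close>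
  proof (cases "B = {}")
    case True
    have "A = {}"
    proof (rule ccontr)
      assume "A \<noteq> {}"
      then have "0 < sum w A"
        using assms(3) fin(1) by (intro sum_pos) (auto simp: weight_def)
      with w True show False by simp
    qed
    with True C show ?thesis
      using mult_right_mono[OF C norm_ge_zero[of x]] by (simp add: ind_def)
  next
    case False
    define y where "y = x + t *\<^sub>R ind e \<epsilon> A + t *\<^sub>R ind e \<eta> B"
    have disj: "n \<notin> B" if "n \<in> A" for n
      using AB that unfolding set_before_def by blast
    have x0: "coef e n x = 0" if "n \<in> A \<union> B" for n
      using supp that unfolding supp_def by blast
    have coef_y: "coef e n y = (if n \<in> A then t * \<epsilon> n else if n \<in> B then t * \<eta> n else coef e n x)" for n
      using disj x0 by (auto simp: y_def coef_simps[OF assms(1)] fin)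
    \<comment> \<open>The coefficients on \<open>A\<close> are tied with those on \<open>B\<close>
      at modulus \<open>t\<close>, and those of \<open>x\<close> do not exceed
      \<open>t\<close>.\<close>
    have greedy: "greedy_set e (card B) y B"
      using disj le t0 fin signs_abs[OF \<epsilon>] signs_abs[OF \<eta>]
      by (auto simp: greedy_set_def coef_y abs_mult)
    \<comment> \<open>Removing \<open>B\<close> from \<open>y\<close> leaves the term on
      \<open>A\<close>, and removing the competitor \<open>A\<close> leaves the term on
      \<open>B\<close>.\<close>
    have "norm (y - proj e B y) \<le> C * norm (y - proj e A y)"
    proof (rule partially_greedyD[OF assms(4) _ greedy _ fin(1) w])
      show "set_before A {Min B}"
        using AB False fin unfolding set_before_def by auto
    qed (use C False fin in \<open>auto simp: Suc_le_eq card_gt_0_iff\<close>)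
    moreover have "proj e B y = t *\<^sub>R ind e \<eta> B"
      by (rule proj_ind_scaled) (use disj in \<open>auto simp: coef_y\<close>)
    moreover have "proj e A y = t *\<^sub>R ind e \<epsilon> A"
      by (rule proj_ind_scaled) (auto simp: coef_y)
    ultimately show ?thesis
      by (simp add: y_def)
  qed
qed

subsection \<open>Partial greediness from the left Property (A)\<close>

text \<open>The vector \<open>e 0\<close> is its own greedy approximant. The bound serves the case
  \<open>m = 0\<close> below and the positivity of the final constant.\<close>

lemma quasi_greedy_ge_1:
  assumes "schauder_basis e" and "normalized e" and "quasi_greedy e C"
  shows "1 \<le> C"
proof -
  define x where "x = ind e (\<lambda>_. 1) {0}"
  have "greedy_set e 1 x {0}"
    by (simp add: greedy_set_def x_def coef_ind[OF assms(1)])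
  then have "norm (proj e {0} x) \<le> C * norm x"
    using assms(3) unfolding quasi_greedy_def by blast
  moreover have "norm (e 0) = 1"
    using assms(2) by (simp add: normalized_def)
  ultimately show ?thesis
    by (simp add: x_def proj_def coef_ind[OF assms(1)]) (simp add: ind_def)
qed

text \<open>Unlike \<open>quasi_greedy\<close>, this admits the empty greedy set, which occurs among
  the sets \<open>S\<close> of \<open>norm_truncation_le\<close>.\<close>

lemma quasi_greedy_norm_diff_le:
  assumes "schauder_basis e" and "normalized e" and "quasi_greedy e C"
    and "greedy_set e m x L"
  shows "norm (x - proj e L x) \<le> (C + 1) * norm x"
proof -
  have "norm (proj e L x) \<le> C * norm x"
  proof (cases "m = 0")
    case True
    with assms(4) have "L = {}" by (auto simp: greedy_set_def)
    with quasi_greedy_ge_1[OF assms(1-3)] show ?thesis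
      by (simp add: proj_def)
  next
    case False
    then have "m \<ge> 1" by simp
    then show ?thesis
      using assms(3,4) unfolding quasi_greedy_def by blast
  qed
  then show ?thesis
    using norm_triangle_ineq4[of x "proj e L x"] by (simp add: algebra_simps)
qed

text \<open>Only indices in \<open>L - S\<close> need a comparison with \<open>S\<close>; those
  outside \<open>L\<close> are already dominated by all of \<open>L\<close>.\<close>

lemma greedy_set_subset:
  assumes "greedy_set e m x L" and "S \<subseteq> L"
    and "\<And>n k. n \<in> S \<Longrightarrow> k \<in> L - S \<Longrightarrow> \<bar>coef e k x\<bar> \<le> \<bar>coef e n x\<bar>"
  shows "greedy_set e (card S) x S"
  using assms unfolding greedy_set_def
  by (metis DiffI finite_subset subsetD)

text \<open>With base vector \<open>u - proj e L u\<close>, the vectors to be bounded for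
  \<open>norm_truncation_le\<close> are remainders \<open>u - proj e S u\<close> for greedy sets
  \<open>S\<close> of \<open>u\<close> inside \<open>L\<close>.\<close>

lemma quasi_greedy_norm_truncation_le:
  assumes "schauder_basis e" and "normalized e" and "quasi_greedy e C"
    and "greedy_set e m u L" and "0 \<le> t" and "\<And>i. i \<in> L \<Longrightarrow> t \<le> \<bar>coef e i u\<bar>"
    and "\<And>i. i \<in> L \<Longrightarrow> coef e i u = \<bar>coef e i u\<bar> * \<eta> i"
  shows "norm (u - proj e L u + t *\<^sub>R ind e \<eta> L) \<le> (C + 1) * norm u"
proof (rule norm_truncation_le[where c = "\<lambda>i. coef e i u"])
  show fin: "finite L" using assms(4) by (simp add: greedy_set_def)
  fix S assume S: "S \<subseteq> L"
    and up: "\<And>n k. n \<in> S \<Longrightarrow> k \<in> L - S \<Longrightarrow> \<bar>coef e k u\<bar> \<le> \<bar>coef e n u\<bar>"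
  have "norm (u - proj e S u) \<le> (C + 1) * norm u"
    by (rule quasi_greedy_norm_diff_le[OF assms(1-3) greedy_set_subset[OF assms(4) S up]])
  moreover have "proj e L u = (\<Sum>i\<in>L - S. coef e i u *\<^sub>R e i) + proj e S u"
    unfolding proj_def by (rule sum.subset_diff[OF S fin])
  ultimately show "norm (u - proj e L u + (\<Sum>i\<in>L - S. coef e i u *\<^sub>R e i)) \<le> (C + 1) * norm u"
    by simp
qed (use assms in auto)

lemma left_property_A_quasi_greedy_norm_le:
  assumes "schauder_basis e" and "normalized e"
    and "left_property_A e w C" and "quasi_greedy e D"
    and "greedy_set e m x L" and "m \<ge> 1"
    and "finite A" and "sum w A \<le> sum w L" and "set_before A {Min L}"
  shows "norm (x - proj e L x) \<le> (D + 1) * C * norm (x - proj e A x)"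
proof -
  note coef = coef_simps[OF assms(1)]
  have fin: "finite L" and L: "L \<noteq> {}"
    using assms(5,6) by (auto simp: greedy_set_def)
  have before: "set_before A L"
    using assms(9) fin by (force simp: set_before_def dest: Min_le)
  then have disj: "n \<notin> L" if "n \<in> A" for n
    using that unfolding set_before_def by blast
  define t where "t = Min ((\<lambda>i. \<bar>coef e i x\<bar>) ` L)"
  \<comment> \<open>A zero coefficient gets the sign 1, so that \<open>\<eta>\<close> takes only the
    values 1 and -1.\<close>
  define \<eta> :: "nat \<Rightarrow> real" where "\<eta> i = (if coef e i x \<ge> 0 then 1 else -1)" for i
  define u where "u = x - proj e A x"
  \<comment> \<open>The part of \<open>x\<close> off \<open>A\<close> and \<open>L\<close>, to which
    the left Property (A) is applied at height \<open>t\<close>.\<close>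
  define z where "z = x - proj e A x - proj e L x"
  obtain l where l: "l \<in> L" "t = \<bar>coef e l x\<bar>"
    using Min_in[of "(\<lambda>i. \<bar>coef e i x\<bar>) ` L"] fin L
    unfolding t_def image_iff by blast
  have t_le: "t \<le> \<bar>coef e i x\<bar>" if "i \<in> L" for i
    using fin that by (simp add: t_def)
  have le_t: "\<bar>coef e k x\<bar> \<le> t" if "k \<notin> L" for k
    using assms(5) l that by (simp add: greedy_set_def)
  have t0: "0 \<le> t" using l by simp
  have coef_u: "coef e n u = (if n \<in> A then 0 else coef e n x)" for n
    by (simp add: u_def coef assms(7))
  have coef_z: "coef e n z = (if n \<in> A \<union> L then 0 else coef e n x)" for n
    using disj by (auto simp: z_def coef assms(7) fin)
  have coef_u_L: "coef e i u = coef e i x" if "i \<in> L" for i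
    using that disj by (auto simp: coef_u)
  then have proj_u: "proj e L u = proj e L x"
    by (simp add: proj_def)
  \<comment> \<open>Passing from \<open>x\<close> to \<open>u\<close> only sets coefficients outside
    \<open>L\<close> to 0, so \<open>L\<close> stays greedy.\<close>
  have greedy_u: "greedy_set e m u L"
    using assms(5) coef_u_L by (auto simp: greedy_set_def coef_u)
  have "x - proj e L x = z + (\<Sum>i\<in>A. coef e i x *\<^sub>R e i)"
    by (simp add: z_def proj_def)
  then obtain \<epsilon> where \<epsilon>: "\<epsilon> \<in> signs" "norm (x - proj e L x) \<le> norm (z + t *\<^sub>R ind e \<epsilon> A)"
    using ex_signs_norm_le[OF assms(7), of "\<lambda>i. coef e i x" t z e] disj le_t by auto
  have "\<eta> \<in> signs" by (simp add: signs_def \<eta>_def)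
  moreover have "(SUP j. \<bar>coef e j z\<bar>) \<le> t"
    by (rule cSUP_least) (use le_t t0 in \<open>auto simp: coef_z\<close>)
  moreover have "supp e z \<inter> (A \<union> L) = {}"
    by (auto simp: supp_def coef_z)
  ultimately have "norm (z + t *\<^sub>R ind e \<epsilon> A) \<le> C * norm (z + t *\<^sub>R ind e \<eta> L)"
    using assms(3,7,8) fin before \<epsilon>(1) unfolding left_property_A_def by blast
  also have "norm (z + t *\<^sub>R ind e \<eta> L) \<le> (D + 1) * norm u"
  proof -
    have "norm (u - proj e L u + t *\<^sub>R ind e \<eta> L) \<le> (D + 1) * norm u"
      by (rule quasi_greedy_norm_truncation_le[OF assms(1,2,4) greedy_u t0])
        (use t_le coef_u_L in \<open>auto simp: \<eta>_def\<close>)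
    then show ?thesis by (simp only: proj_u) (simp add: u_def z_def)
  qed
  then have "C * norm (z + t *\<^sub>R ind e \<eta> L) \<le> C * ((D + 1) * norm u)"
    using assms(3) by (intro mult_left_mono) (auto simp: left_property_A_def)
  finally show ?thesis
    using \<epsilon>(2) by (simp add: u_def mult_ac)
qed

lemma left_property_A_quasi_greedy_imp_partially_greedy:
  assumes "schauder_basis e" and "normalized e" and "weight w"
    and "left_property_A e w C" and "quasi_greedy e D"
  shows "partially_greedy e w ((D + 1) * C)"
  unfolding partially_greedy_def
proof (intro allI impI, elim conjE)
  fix x m L assume m: "m \<ge> (1::nat)" and greedy: "greedy_set e m x L"
  let ?F = "{A. finite A \<and> sum w A \<le> sum w L \<and> set_before A {Min L}}"
  let ?K = "(D + 1) * C"
  have K: "0 < ?K"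
    using quasi_greedy_ge_1[OF assms(1,2,5)] assms(4) by (simp add: left_property_A_def)
  have "norm (x - proj e L x) / ?K \<le> (INF A\<in>?F. norm (x - proj e A x))"
  proof (rule cINF_greatest)
    \<comment> \<open>The empty competitor ensures that the infimum is taken over a nonempty
      set.\<close>
    have "{} \<in> ?F"
      using sum_weight_nonneg[OF assms(3)] by (simp add: set_before_def)
    then show "?F \<noteq> {}" by blast
    show "norm (x - proj e L x) / ?K \<le> norm (x - proj e A x)" if "A \<in> ?F" for A
      using left_property_A_quasi_greedy_norm_le[OF assms(1,2,4,5) greedy m, of A] that K
      by (simp add: pos_divide_le_eq mult.commute)
  qed
  then show "norm (x - proj e L x) \<le> ?K * (INF A\<in>?F. norm (x - proj e A x))"
    using K by (simp add: pos_divide_le_eq mult.commute)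
qed

theorem theorem3p12:
  fixes e :: "nat \<Rightarrow> 'a::banach" and w :: "nat \<Rightarrow> real"
  assumes "schauder_basis e" and "normalized e" and "weight w"
  shows "(\<forall>C\<^sub>p. partially_greedy e w C\<^sub>p \<longrightarrow>
            quasi_greedy e (C\<^sub>p + 1) \<and> left_property_A e w C\<^sub>p) \<and>
         (\<forall>C\<^sub>l\<^sub>a C\<^sub>q. left_property_A e w C\<^sub>l\<^sub>a \<and> quasi_greedy e C\<^sub>q \<longrightarrow>
            partially_greedy e w ((C\<^sub>q + 1) * C\<^sub>l\<^sub>a))"
  using partially_greedy_imp_quasi_greedy[OF assms] partially_greedy_imp_left_property_A[OF assms]
    left_property_A_quasi_greedy_imp_partially_greedy[OF assms]
  by blast

end
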